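(* Let $\{X_n\}_{n\ge0}$ be a Markov chain with state space $\{1,2,3\}$ and transition matrix $P=[p_{ij}]$. The first passage time distribution $f_{12}^{(n)}=P\{T_{12}=n\}$ from state $1$ to state $2$ is given by $$f_{12}^{(1)}=p_{12},\quad f_{12}^{(2)}=p_{11}p_{12}+p_{13}p_{32},\quad f_{12}^{(3)}=p_{11}p_{11}p_{12}+p_{11}p_{13}p_{32}+p_{13}p_{33}p_{32}+p_{13}p_{31}p_{12},$$ and, in general, for $n\ge3$, provided $\delta_2>0$, $$f_{12}^{(n)}=\frac{a(\lambda_{21})}{\lambda_{21}-\lambda_{23}}\lambda_{21}^{n-1}-\frac{a(\lambda_{23})}{\lambda_{21}-\lambda_{23}}\lambda_{23}^{n-1},$$ where $$\lambda_{21}=\frac{p_{11}+p_{33}+\delta_2}{2},\quad\lambda_{23}=\frac{p_{11}+p_{33}-\delta_2}{2},\quad\delta_2=\sqrt{(p_{11}-p_{33})^2+4p_{13}p_{31}},$$ and $a(\lambda)=p_{12}\lambda+p_{13}p_{32}-p_{12}p_{33}$.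
   Context: $T_{12}=\min\{n\ge1:X_n=2\}$ given $X_0=1$, so $f_{12}^{(n)}=P\{X_n=2,\ X_k\ne2\text{ for }k=1,\dots,n-1\mid X_0=1\}$. *)

theory Defs
  imports "HOL-Probability.Probability"
begin

definition stochastic_matrix :: "real ^ 's ^ 's \<Rightarrow> bool" where
  "stochastic_matrix P \<longleftrightarrow>
     (\<forall>i j. 0 \<le> P $ i $ j) \<and> (\<forall>i. (\<Sum>j\<in>UNIV. P $ i $ j) = 1)"

text \<open>
  A time-homogeneous Markov chain on a finite state space, with arbitrary initial distribution.
  The Markov property is only required for histories of positive probability, because
  \<^const>\<open>cond_prob\<close> is \<open>0\<close> when the conditioning event is null. As this leaves the rows of states
  that are never reached unconstrained, stochasticity of the matrix is a separate assumption.
\<close>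

locale markov_chain = prob_space M
  for M :: "'a measure" +
  fixes X :: "nat \<Rightarrow> 'a \<Rightarrow> 's :: finite"
    and P :: "real ^ 's ^ 's"
  assumes random_variable_X: "\<And>n. random_variable (count_space UNIV) (X n)"
    and stochastic: "stochastic_matrix P"
    and markov_property:
      "\<And>n s j. prob {\<omega> \<in> space M. \<forall>k\<le>n. X k \<omega> = s k} > 0 \<Longrightarrow>
        \<P>(\<omega> in M. X (Suc n) \<omega> = j \<bar> \<forall>k\<le>n. X k \<omega> = s k) = P $ s n $ j"

text \<open>The value is \<open>\<infinity>\<close> if the state \<open>j\<close> is not visited at any time \<open>n \<ge> 1\<close>.\<close>

definition first_passage_time :: "(nat \<Rightarrow> 'a \<Rightarrow> 's) \<Rightarrow> 's \<Rightarrow> 'a \<Rightarrow> enat" where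
  "first_passage_time X j \<omega> = Inf {enat n | n. n \<ge> 1 \<and> X n \<omega> = j}"

definition first_passage_prob ::
    "'a measure \<Rightarrow> (nat \<Rightarrow> 'a \<Rightarrow> 's) \<Rightarrow> 's \<Rightarrow> 's \<Rightarrow> nat \<Rightarrow> real" where
  "first_passage_prob M X i j n =
     \<P>(\<omega> in M. first_passage_time X j \<omega> = enat n \<bar> X 0 \<omega> = i)"

text \<open>
  The state space \<open>{1, 2, 3}\<close> is rendered by the numeral type \<open>3\<close>, whose three elements
  are \<open>1\<close>, \<open>2\<close> and \<open>3\<close>, see \<open>UNIV_3\<close>; in this type \<open>3 = 0\<close>.
\<close>

end

theory Submission
  imports Defs
begin

text \<open>
  Conditioning on the last state before the passage turns \<open>f\<^sub>i\<^sub>j\<^sup>(\<^sup>n\<^sup>)\<close> into entry \<open>(i, j)\<close> of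
  \<open>Q\<^sup>n\<^sup>-\<^sup>1 P\<close>, where \<open>Q\<close> is \<open>P\<close> with column \<open>j\<close> set to zero. For three states \<open>Q\<close> acts as a
  \<open>2 \<times> 2\<close> matrix whose eigenvalues are \<open>\<lambda>\<^sub>2\<^sub>1\<close> and \<open>\<lambda>\<^sub>2\<^sub>3\<close>. By Cayley-Hamilton the sequence satisfies
  a linear recurrence of order two with these characteristic roots, which the
  closed form solves.
\<close>

text \<open>The row vector of index \<open>i\<close> of the \<open>n\<close>-th power of the matrix
  with column \<open>j\<close> set to zero: the classical taboo probabilities, with \<open>j\<close>
  forbidden at times 1 to \<open>n\<close>. Time 0 is exempt, so the start may be \<open>j\<close>
  itself.\<close>

primrec taboo_prob :: "real ^ 's ^ 's \<Rightarrow> 's \<Rightarrow> 's \<Rightarrow> nat \<Rightarrow> 's :: finite \<Rightarrow> real" where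
  "taboo_prob P i j 0 h = (if h = i then 1 else 0)"
| "taboo_prob P i j (Suc n) h =
     (if h = j then 0 else \<Sum>l\<in>UNIV. taboo_prob P i j n l * P $ l $ h)"

lemma first_passage_time_eq_enat_iff:
  assumes "n \<ge> 1"
  shows "first_passage_time X j \<omega> = enat n \<longleftrightarrow> X n \<omega> = j \<and> (\<forall>k\<in>{1..<n}. X k \<omega> \<noteq> j)"
proof
  let ?A = "{enat n | n. n \<ge> 1 \<and> X n \<omega> = j}"
  assume eq: "first_passage_time X j \<omega> = enat n"
  \<comment> \<open>The infimum of the empty set is \<infinity>, so a finite value forces a visit to
    \<open>j\<close>; by well-ordering the infimum is then attained.\<close>
  then have "?A \<noteq> {}"
    unfolding first_passage_time_def by (intro notI) (simp add: Inf_enat_def)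
  then have "Inf ?A \<in> ?A"
    unfolding Inf_enat_def by (auto intro: LeastI)
  then have "X n \<omega> = j"
    using eq unfolding first_passage_time_def by auto
  moreover have "X k \<omega> \<noteq> j" if "k \<in> {1..<n}" for k
  proof
    assume "X k \<omega> = j"
    then have "Inf ?A \<le> enat k"
      using that by (intro Inf_lower) auto
    then show False
      using eq that unfolding first_passage_time_def by auto
  qed
  ultimately show "X n \<omega> = j \<and> (\<forall>k\<in>{1..<n}. X k \<omega> \<noteq> j)"
    by blast
next
  assume *: "X n \<omega> = j \<and> (\<forall>k\<in>{1..<n}. X k \<omega> \<noteq> j)"
  show "first_passage_time X j \<omega> = enat n"
    unfolding first_passage_time_def
  proof (rule antisym)
    show "Inf {enat n | n. n \<ge> 1 \<and> X n \<omega> = j} \<le> enat n"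
      using * assms by (intro Inf_lower) auto
    show "enat n \<le> Inf {enat n | n. n \<ge> 1 \<and> X n \<omega> = j}"
      using * by (intro Inf_greatest) (auto simp: not_less[symmetric])
  qed
qed

context markov_chain
begin

lemma measurable_X [measurable]: "X n \<in> measurable M (count_space UNIV)"
  by (rule random_variable_X)

text \<open>Product form of the Markov property. It also covers null histories, where both sides
  vanish by monotonicity.\<close>

lemma prob_path_Suc:
  "prob {\<omega> \<in> space M. (\<forall>k\<le>n. X k \<omega> = s k) \<and> X (Suc n) \<omega> = l} =
     prob {\<omega> \<in> space M. \<forall>k\<le>n. X k \<omega> = s k} * P $ s n $ l"
proof (cases "prob {\<omega> \<in> space M. \<forall>k\<le>n. X k \<omega> = s k} > 0")
  case True
  then show ?thesis
    using markov_property[OF True, of l] by (simp add: cond_prob_def field_simps conj_commute)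
next
  case False
  then have 0: "prob {\<omega> \<in> space M. \<forall>k\<le>n. X k \<omega> = s k} = 0"
    by (simp add: zero_less_measure_iff)
  have "prob {\<omega> \<in> space M. (\<forall>k\<le>n. X k \<omega> = s k) \<and> X (Suc n) \<omega> = l} \<le>
      prob {\<omega> \<in> space M. \<forall>k\<le>n. X k \<omega> = s k}"
    by (intro finite_measure_mono) auto
  then show ?thesis
    using 0 by (simp add: measure_le_0_iff)
qed

text \<open>The event \<open>Q\<close> depends only on times up to \<open>n\<close>
  (\<open>cong\<close>) and fixes the state at time \<open>n\<close> (\<open>last\<close>). It
  splits into finitely many single paths, all of which contribute the same factor
  \<open>P $ h $ l\<close>.\<close>

lemma prob_history_Suc:
  assumes cong: "\<And>x y. (\<And>k. k \<le> n \<Longrightarrow> x k = y k) \<Longrightarrow> Q x \<Longrightarrow> Q y"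
    and last: "\<And>x. Q x \<Longrightarrow> x n = h"
  shows "prob {\<omega> \<in> space M. Q (\<lambda>k. X k \<omega>) \<and> X (Suc n) \<omega> = l} =
     prob {\<omega> \<in> space M. Q (\<lambda>k. X k \<omega>)} * P $ h $ l"
proof -
  \<comment> \<open>Extensional functions serve as histories: there are finitely many, and each
    trajectory agrees with at most one of them, which gives disjointness.\<close>
  define S where "S = {s \<in> {..n} \<rightarrow>\<^sub>E (UNIV :: 's set). Q s}"
  have fin: "finite S"
    unfolding S_def by (intro finite_subset[OF _ finite_PiE[of "{..n}" "\<lambda>_. UNIV"]]) auto
  have Q_iff: "Q (\<lambda>k. X k \<omega>) \<longleftrightarrow> (\<exists>s\<in>S. \<forall>k\<le>n. X k \<omega> = s k)" for \<omega>
  proof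
    assume Q: "Q (\<lambda>k. X k \<omega>)"
    have "Q (restrict (\<lambda>k. X k \<omega>) {..n})"
      by (rule cong[OF _ Q]) auto
    then have "restrict (\<lambda>k. X k \<omega>) {..n} \<in> S"
      unfolding S_def by auto
    then show "\<exists>s\<in>S. \<forall>k\<le>n. X k \<omega> = s k"
      by (rule bexI[rotated]) auto
  next
    assume "\<exists>s\<in>S. \<forall>k\<le>n. X k \<omega> = s k"
    then obtain s where "Q s" "\<forall>k\<le>n. X k \<omega> = s k"
      unfolding S_def by auto
    then show "Q (\<lambda>k. X k \<omega>)"
      using cong[of s "\<lambda>k. X k \<omega>"] by simp
  qed
  have unique: "s = t" if "s \<in> S" "t \<in> S" "\<forall>k\<le>n. x k = s k" "\<forall>k\<le>n. x k = t k" for s t x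
    using that unfolding S_def by (intro PiE_ext[of s "{..n}" _ t]) auto
  \<comment> \<open>\<open>R\<close> is kept general: it is used for the next step
    \<open>X (Suc n) \<omega> = l\<close> and for the trivial event.\<close>
  have split: "prob {\<omega> \<in> space M. Q (\<lambda>k. X k \<omega>) \<and> R \<omega>} =
      (\<Sum>s\<in>S. prob {\<omega> \<in> space M. (\<forall>k\<le>n. X k \<omega> = s k) \<and> R \<omega>})"
    if [measurable]: "Measurable.pred M R" for R
  proof -
    have "{\<omega> \<in> space M. Q (\<lambda>k. X k \<omega>) \<and> R \<omega>} =
        (\<Union>s\<in>S. {\<omega> \<in> space M. (\<forall>k\<le>n. X k \<omega> = s k) \<and> R \<omega>})"
      using Q_iff by auto
    also have "prob \<dots> = (\<Sum>s\<in>S. prob {\<omega> \<in> space M. (\<forall>k\<le>n. X k \<omega> = s k) \<and> R \<omega>})"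
    proof (intro finite_measure_finite_Union fin)
      show "disjoint_family_on (\<lambda>s. {\<omega> \<in> space M. (\<forall>k\<le>n. X k \<omega> = s k) \<and> R \<omega>}) S"
        unfolding disjoint_family_on_def using unique by fastforce
    qed auto
    finally show ?thesis .
  qed
  have "prob {\<omega> \<in> space M. Q (\<lambda>k. X k \<omega>) \<and> X (Suc n) \<omega> = l} =
      (\<Sum>s\<in>S. prob {\<omega> \<in> space M. \<forall>k\<le>n. X k \<omega> = s k} * P $ s n $ l)"
    by (simp add: split prob_path_Suc)
  also have "\<dots> = (\<Sum>s\<in>S. prob {\<omega> \<in> space M. \<forall>k\<le>n. X k \<omega> = s k}) * P $ h $ l"
    unfolding sum_distrib_right using last by (intro sum.cong) (auto simp: S_def)
  also have "(\<Sum>s\<in>S. prob {\<omega> \<in> space M. \<forall>k\<le>n. X k \<omega> = s k}) =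
      prob {\<omega> \<in> space M. Q (\<lambda>k. X k \<omega>)}"
    using split[of "\<lambda>_. True"] by simp
  finally show ?thesis .
qed

text \<open>Avoiding \<open>j\<close> does not determine the current state, so the event is split by
  the value \<open>h\<close> of \<open>X n\<close> before the Markov property is applied.\<close>

lemma prob_taboo_step:
  "prob {\<omega> \<in> space M. X 0 \<omega> = i \<and> (\<forall>k\<in>{1..n}. X k \<omega> \<noteq> j) \<and> X (Suc n) \<omega> = l} =
     (\<Sum>h\<in>UNIV. prob {\<omega> \<in> space M. X 0 \<omega> = i \<and> (\<forall>k\<in>{1..n}. X k \<omega> \<noteq> j) \<and> X n \<omega> = h} * P $ h $ l)"
proof -
  let ?Q = "\<lambda>h x. x 0 = i \<and> (\<forall>k\<in>{1..n}. x k \<noteq> j) \<and> x n = h"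
  have "{\<omega> \<in> space M. X 0 \<omega> = i \<and> (\<forall>k\<in>{1..n}. X k \<omega> \<noteq> j) \<and> X (Suc n) \<omega> = l} =
      (\<Union>h\<in>UNIV. {\<omega> \<in> space M. ?Q h (\<lambda>k. X k \<omega>) \<and> X (Suc n) \<omega> = l})"
    by auto
  also have "prob \<dots> = (\<Sum>h\<in>UNIV. prob {\<omega> \<in> space M. ?Q h (\<lambda>k. X k \<omega>) \<and> X (Suc n) \<omega> = l})"
    by (intro finite_measure_finite_Union) (auto simp: disjoint_family_on_def)
  also have "\<dots> = (\<Sum>h\<in>UNIV. prob {\<omega> \<in> space M. ?Q h (\<lambda>k. X k \<omega>)} * P $ h $ l)"
    by (intro sum.cong refl prob_history_Suc) auto
  finally show ?thesis .
qed

text \<open>Joint rather than conditional probabilities keep the induction free of any positivity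
  condition on the start.\<close>

lemma prob_taboo:
  "prob {\<omega> \<in> space M. X 0 \<omega> = i \<and> (\<forall>k\<in>{1..n}. X k \<omega> \<noteq> j) \<and> X n \<omega> = h} =
     prob {\<omega> \<in> space M. X 0 \<omega> = i} * taboo_prob P i j n h"
proof (induction n arbitrary: h)
  case 0
  have "{\<omega> \<in> space M. X 0 \<omega> = i \<and> X 0 \<omega> = h} =
      (if h = i then {\<omega> \<in> space M. X 0 \<omega> = i} else {})"
    by auto
  then show ?case
    by simp
next
  case (Suc n)
  \<comment> \<open>At time \<open>Suc n\<close> the taboo contradicts \<open>h = j\<close> and is
    implied by \<open>X (Suc n) \<omega> = h\<close> otherwise.\<close>
  have "{\<omega> \<in> space M. X 0 \<omega> = i \<and> (\<forall>k\<in>{1..Suc n}. X k \<omega> \<noteq> j) \<and> X (Suc n) \<omega> = h} =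
      (if h = j then {}
       else {\<omega> \<in> space M. X 0 \<omega> = i \<and> (\<forall>k\<in>{1..n}. X k \<omega> \<noteq> j) \<and> X (Suc n) \<omega> = h})"
    by (auto simp: atLeastAtMostSuc_conv)
  then show ?case
    by (simp only: prob_taboo_step Suc.IH if_distrib[of prob] taboo_prob.simps)
       (simp add: sum_distrib_left mult.assoc)
qed

text \<open>A first passage at time \<open>Suc n\<close> is a taboo path of length \<open>n\<close>
  followed by a step into \<open>j\<close>; the positive probability of the start cancels.\<close>

lemma first_passage_prob_Suc:
  assumes "prob {\<omega> \<in> space M. X 0 \<omega> = i} > 0"
  shows "first_passage_prob M X i j (Suc n) = (\<Sum>h\<in>UNIV. taboo_prob P i j n h * P $ h $ j)"
proof -
  have "{\<omega> \<in> space M. first_passage_time X j \<omega> = enat (Suc n) \<and> X 0 \<omega> = i} =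
      {\<omega> \<in> space M. X 0 \<omega> = i \<and> (\<forall>k\<in>{1..n}. X k \<omega> \<noteq> j) \<and> X (Suc n) \<omega> = j}"
    by (auto simp: first_passage_time_eq_enat_iff)
  then show ?thesis
    using assms
    by (simp only: first_passage_prob_def cond_prob_def prob_taboo_step prob_taboo mult.assoc
        sum_distrib_left[symmetric]) simp
qed

end

text \<open>Since \<open>x\<close> and \<open>y\<close> are the roots of
  \<open>z^2 - (x + y) * z + x * y\<close>, both power sequences solve the recurrence; the
  coefficients match the values at 0 and 1.\<close>

lemma linear_recurrence_order_two:
  fixes g :: "nat \<Rightarrow> 'a :: field"
  assumes "x \<noteq> y"
    and rec: "\<And>n. g (Suc (Suc n)) = (x + y) * g (Suc n) - x * y * g n"
  shows "g n = (g 1 - y * g 0) / (x - y) * x ^ n - (g 1 - x * g 0) / (x - y) * y ^ n"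
proof (induction n rule: induct_nat_012)
  case 0
  show ?case
    using assms(1) by (simp add: diff_divide_distrib[symmetric] algebra_simps) (simp add: field_simps)
next
  case 1
  have "(g 1 - y * g 0) * x - (g 1 - x * g 0) * y = g 1 * (x - y)"
    by (simp add: algebra_simps)
  then show ?case
    using assms(1) by (simp add: diff_divide_distrib[symmetric])
next
  case (ge2 n)
  show ?case
    unfolding rec ge2.IH by (simp add: divide_inverse algebra_simps)
qed

theorem theorem4p3:
  fixes M :: "'a measure"
    and X :: "nat \<Rightarrow> 'a \<Rightarrow> 3"
    and P :: "real ^ 3 ^ 3"
    and del2 lam21 lam23 :: real
    and a :: "real \<Rightarrow> real"
    and f12 :: "nat \<Rightarrow> real"
  assumes chain: "markov_chain M X P"
    and start: "measure M {\<omega> \<in> space M. X 0 \<omega> = 1} > 0"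
    and f12: "f12 = first_passage_prob M X 1 2"
    and del2: "del2 = sqrt ((P $ 1 $ 1 - P $ 3 $ 3)\<^sup>2 + 4 * P $ 1 $ 3 * P $ 3 $ 1)"
    and lam21: "lam21 = (P $ 1 $ 1 + P $ 3 $ 3 + del2) / 2"
    and lam23: "lam23 = (P $ 1 $ 1 + P $ 3 $ 3 - del2) / 2"
    and a: "\<And>z. a z = P $ 1 $ 2 * z + P $ 1 $ 3 * P $ 3 $ 2 - P $ 1 $ 2 * P $ 3 $ 3"
  shows "f12 1 = P $ 1 $ 2 \<and>
    f12 2 = P $ 1 $ 1 * P $ 1 $ 2 + P $ 1 $ 3 * P $ 3 $ 2 \<and>
    f12 3 = P $ 1 $ 1 * P $ 1 $ 1 * P $ 1 $ 2 + P $ 1 $ 1 * P $ 1 $ 3 * P $ 3 $ 2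
      + P $ 1 $ 3 * P $ 3 $ 3 * P $ 3 $ 2 + P $ 1 $ 3 * P $ 3 $ 1 * P $ 1 $ 2 \<and>
    (del2 > 0 \<longrightarrow> (\<forall>n\<ge>3.
      f12 n = a lam21 / (lam21 - lam23) * lam21 ^ (n - 1) - a lam23 / (lam21 - lam23) * lam23 ^ (n - 1)))"
proof -
  interpret markov_chain M X P
    by (rule chain)
  define t where "t = taboo_prob P 1 2"
  \<comment> \<open>The shift starts the recurrence at index 0 and produces the exponent
    \<open>n - 1\<close>.\<close>
  define g where "g n = f12 (Suc n)" for n
  \<comment> \<open>No mass sits on state 2: at time 0 the chain is in state 1, later 2 is taboo.
    Only the block on states 1 and 3 remains.\<close>
  have t_2: "t n 2 * P $ 2 $ h = 0" for n h
    unfolding t_def by (cases n) simp_all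
  have t_0: "t 0 1 = 1" "t 0 3 = 0"
    unfolding t_def by simp_all
  have t_Suc: "t (Suc n) 1 = t n 1 * P $ 1 $ 1 + t n 3 * P $ 3 $ 1"
    "t (Suc n) 3 = t n 1 * P $ 1 $ 3 + t n 3 * P $ 3 $ 3" for n
    using t_2 unfolding t_def by (simp_all add: sum_3)
  have g: "g n = t n 1 * P $ 1 $ 2 + t n 3 * P $ 3 $ 2" for n
    using t_2 unfolding g_def f12 t_def by (simp add: first_passage_prob_Suc[OF start] sum_3)
  have g_0: "g 0 = P $ 1 $ 2"
    and g_1: "g 1 = P $ 1 $ 1 * P $ 1 $ 2 + P $ 1 $ 3 * P $ 3 $ 2"
    by (simp_all add: g t_0 t_Suc)
  have g_2: "g 2 = P $ 1 $ 1 * P $ 1 $ 1 * P $ 1 $ 2 + P $ 1 $ 1 * P $ 1 $ 3 * P $ 3 $ 2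
      + P $ 1 $ 3 * P $ 3 $ 3 * P $ 3 $ 2 + P $ 1 $ 3 * P $ 3 $ 1 * P $ 1 $ 2"
    by (simp add: g t_0 t_Suc numeral_2_eq_2 algebra_simps)
  have f12_eq: "f12 1 = g 0" "f12 2 = g 1" "f12 3 = g 2"
    by (simp_all add: g_def numeral_2_eq_2 numeral_3_eq_3)
  have closed_form: "f12 n = a lam21 / (lam21 - lam23) * lam21 ^ (n - 1)
      - a lam23 / (lam21 - lam23) * lam23 ^ (n - 1)" if "del2 > 0" "n \<ge> 3" for n
  proof -
    have sum: "lam21 + lam23 = P $ 1 $ 1 + P $ 3 $ 3"
      by (simp add: lam21 lam23 field_simps)
    \<comment> \<open>Nonnegative entries make the radicand nonnegative, so squaring undoes the
      root.\<close>
    have "0 \<le> (P $ 1 $ 1 - P $ 3 $ 3)\<^sup>2 + 4 * P $ 1 $ 3 * P $ 3 $ 1"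
      using stochastic unfolding stochastic_matrix_def by simp
    then have "del2\<^sup>2 = (P $ 1 $ 1 - P $ 3 $ 3)\<^sup>2 + 4 * P $ 1 $ 3 * P $ 3 $ 1"
      by (simp add: del2)
    then have prod: "lam21 * lam23 = P $ 1 $ 1 * P $ 3 $ 3 - P $ 1 $ 3 * P $ 3 $ 1"
      by (simp add: lam21 lam23 field_simps power2_eq_square)
    \<comment> \<open>Cayley-Hamilton for the block on states 1 and 3: \<open>sum\<close> is its
      trace, \<open>prod\<close> its determinant.\<close>
    have "g (Suc (Suc m)) = (lam21 + lam23) * g (Suc m) - lam21 * lam23 * g m" for m
      unfolding sum prod by (simp add: g t_Suc algebra_simps)
    moreover have "lam21 \<noteq> lam23"
      using that by (simp add: lam21 lam23)
    ultimately have "g (n - 1) = (g 1 - lam23 * g 0) / (lam21 - lam23) * lam21 ^ (n - 1)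
        - (g 1 - lam21 * g 0) / (lam21 - lam23) * lam23 ^ (n - 1)"
      by (intro linear_recurrence_order_two)
    \<comment> \<open>By the trace identity, \<open>P $ 1 $ 1 - lam23 = lam21 - P $ 3 $ 3\<close>,
      and likewise with the roots exchanged.\<close>
    moreover have "g 1 - lam23 * g 0 = a lam21" "g 1 - lam21 * g 0 = a lam23"
      unfolding g_0 g_1 a lam21 lam23 by (simp_all add: field_simps)
    moreover have "f12 n = g (n - 1)"
      using that by (simp add: g_def)
    ultimately show ?thesis
      by simp
  qed
  show ?thesis
    using f12_eq g_0 g_1 g_2 closed_form by simp
qed

end
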